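(* Consider the sequential explicit scheme for the rescaled two-dimensional Euler equations described in the context, and expand all discrete quantities formally as power series in $\epsilon$. As $\epsilon\to 0$, the limit equations (L1), (L2), (L3) of the scheme (written out in the context) are solved by $$p_{ij}=\mathrm{const}+\mathcal O(\epsilon^2)\quad\text{for all } i,j$$ (i.e. $p^{(0)}_{ij}$ and $p^{(1)}_{ij}$ are constant, independent of $i,j$ and of the time level) together with $$\mathscr D_{i+\frac12,j+\frac12}:=\frac{u_{i+1,j}-u_{ij}+u_{i+1,j+1}-u_{i,j+1}}{2\Delta x}+\frac{v_{i+1,j+1}-v_{i+1,j}+v_{i,j+1}-v_{ij}}{2\Delta y}\in\mathcal O(\epsilon)\quad\text{for all } i,j$$ (i.e. the coefficient $\mathscr D^{(0)}_{i+\frac12,j+\frac12}$, formed with $u^{(0)},v^{(0)}$, vanishes at every vertex), where $(u,v)$ is each of the velocity fields entering the fluxes: $\vec m^n/\rho^n$ in the momentum update and $\vec m^{n+1}/\rho^n$ in the energy update. That is, whenever the discrete data satisfy these two conditions, all limit equations hold.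
   Context: **Rescaled Euler equations.** For $\epsilon>0$, in two space dimensions with density $\rho$, velocity $\vec v=(u,v)$, momentum $\vec m=\rho\vec v$, energy $e$: $\partial_t\rho+\nabla\cdot(\rho\vec v)=0$, $\partial_t(\rho\vec v)+\nabla\cdot(\rho\vec v\otimes\vec v+\frac{p}{\epsilon^2}\mathrm{Id})=0$, $\partial_t e+\nabla\cdot(\vec v(e+p))=0$, with $e=\frac{p}{\gamma-1}+\frac12\epsilon^2\rho|\vec v|^2$, $\gamma>1$. With $q=(\rho,\rho u,\rho v,e)$ the fluxes are $f^x(q)=(\rho u,\ \rho u^2+p/\epsilon^2,\ \rho uv,\ u(e+p))$, $f^y(q)=(\rho v,\ \rho uv,\ \rho v^2+p/\epsilon^2,\ v(e+p))$. **Notation on a Cartesian grid** with spacings $\Delta x,\Delta y>0$ and cells $(i,j)$. In one direction: $[q]_{i+\frac12}=q_{i+1}-q_i$, $\{q\}_{i+\frac12}=q_{i+1}+q_i$, $[q]_{i\pm1}=q_{i+1}-q_{i-1}$, $[q]_{i\pm\frac12}=q_{i+\frac12}-q_{i-\frac12}$ (for quantities living at edges), $\{\{q\}\}_{i\pm\frac12}=q_{i+1}+2q_i+q_{i-1}$; in two dimensions these operators act on the index $i$ or $j$ individually and may be composed, e.g. $\{\{[q]_{i+\frac12}\}\}_{j\pm\frac12}=[q]_{i+\frac12,j+1}+2[q]_{i+\frac12,j}+[q]_{i+\frac12,j-1}$. **Edge divergences.** $$d^x_{i+\frac12,j}=\frac{\{\{[u]_{i+\frac12}\}\}_{j\pm\frac12}}{4\Delta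 x}+\frac{[\{v\}_{i+\frac12}]_{j\pm1}}{4\Delta y},\qquad d^y_{i,j+\frac12}=\frac{\{[u]_{i\pm1}\}_{j+\frac12}}{4\Delta x}+\frac{[\{\{v\}\}_{i\pm\frac12}]_{j+\frac12}}{4\Delta y}.$$ **Numerical fluxes.** $$f^x_{i+\frac12,j}=\frac{\frac18\{\{\{f^x(q)\}_{i+\frac12}\}\}_{j\pm\frac12}-\frac12|u^*_{i+\frac12,j}|\,[q]_{i+\frac12,j}}{1+\Delta t\,d^x_{i+\frac12,j}},\qquad f^y_{i,j+\frac12}=\frac{\frac18\{\{\{f^y(q)\}\}_{i\pm\frac12}\}_{j+\frac12}-\frac12|v^*_{i,j+\frac12}|\,[q]_{i,j+\frac12}}{1+\Delta t\,d^y_{i,j+\frac12}},$$ with $u^*_{i+\frac12,j}=\frac12(u_{i+1,j}+u_{ij})$, $v^*_{i,j+\frac12}=\frac12(v_{i,j+1}+v_{ij})$. Set $$\mathrm{RHS}_{ij}(\rho,\vec m,e)=\frac{f^x_{i+\frac12,j}-f^x_{i-\frac12,j}}{\Delta x}+\frac{f^y_{i,j+\frac12}-f^y_{i,j-\frac12}}{\Delta y},$$ where $(u,v)=\vec m/\rho$ and $p$ is given by the equation of state; superscripts $\vec m,\rho,e$ denote components. **Scheme** (time step $\Delta t>0$ fixed): $\vec m^{n+1}_{ij}=\vec m^n_{ij}-\Delta t\,\mathrm{RHS}^{\vec m}_{ij}(\rho^n,\vec m^n,e^n)$, then $\rho^{n+1}_{ij}=\rho^n_{ij}-\Delta t\,\mathrm{RHS}^{\rho}_{ij}(\rho^n,\vec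 m^{n+1},e^n)$ and $e^{n+1}_{ij}=e^n_{ij}-\Delta t\,\mathrm{RHS}^{e}_{ij}(\rho^n,\vec m^{n+1},e^n)$. **Expansion.** Every discrete quantity is written $a=a^{(0)}+\epsilon a^{(1)}+\epsilon^2a^{(2)}+\mathcal O(\epsilon^3)$. In particular $e^{(0)}=p^{(0)}/(\gamma-1)$. **Limit equations.** For $\ell=0,1$ and all $i,j$, with $d^{x,(0)},d^{y,(0)}$ the edge divergences formed with $u^{(0)},v^{(0)}$ (velocity $\vec m^n/\rho^n$): $$\text{(L1)}\quad \frac1{8\Delta x}\left(\frac{\{\{\{p^{(\ell)}\}_{i+\frac12}\}\}_{j\pm\frac12}}{1+\Delta t\,d^{x,(0)}_{i+\frac12,j}}-\frac{\{\{\{p^{(\ell)}\}_{i-\frac12}\}\}_{j\pm\frac12}}{1+\Delta t\,d^{x,(0)}_{i-\frac12,j}}\right)=0,$$ $$\text{(L2)}\quad \frac1{8\Delta y}\left(\frac{\{\{\{p^{(\ell)}\}\}_{i\pm\frac12}\}_{j+\frac12}}{1+\Delta t\,d^{y,(0)}_{i,j+\frac12}}-\frac{\{\{\{p^{(\ell)}\}\}_{i\pm\frac12}\}_{j-\frac12}}{1+\Delta t\,d^{y,(0)}_{i,j-\frac12}}\right)=0,$$ and the $\mathcal O(1)$ energy equation $$\text{(L3)}\quad \frac{e^{(0),n+1}_{ij}-e^{(0),n}_{ij}}{\Delta t}+\mathrm{RHS}^{e,(0)}_{ij}=0,$$ where $\mathrm{RHS}^{e,(0)}_{ij}$ is the energy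 component of $\mathrm{RHS}_{ij}$ with all quantities replaced by their order-zero coefficients (energy $e^{(0),n}$, pressure $p^{(0)}=(\gamma-1)e^{(0),n}$, velocity the order-zero coefficient of $\vec m^{n+1}/\rho^n$). *)

theory Defs
  imports Complex_Main "HOL-Computational_Algebra.Formal_Power_Series"
begin

text \<open>
  A grid function assigns a value to each cell \<open>(i, j)\<close> of the unbounded Cartesian grid.
  A quantity living on edges or vertices is indexed by rounding its half-integer indices down:
  \<open>(i + 1/2, j)\<close>, \<open>(i, j + 1/2)\<close> and \<open>(i + 1/2, j + 1/2)\<close> are all stored at \<open>(i, j)\<close>.
\<close>

type_synonym 'a grid = "int \<Rightarrow> int \<Rightarrow> 'a"

section \<open>Difference and averaging operators\<close>

text \<open>
  The suffix gives the index acted on. In the order below: \<open>[q]\<close> and \<open>{q}\<close> at \<open>i + 1/2\<close>,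
  \<open>[q]\<close> at \<open>i \<plusminus> 1\<close>, and \<open>{{q}}\<close> at \<open>i \<plusminus> 1/2\<close>.
\<close>

definition jump_x :: "'a::comm_ring_1 grid \<Rightarrow> 'a grid" where
  "jump_x q i j = q (i + 1) j - q i j"

definition sum_x :: "'a::comm_ring_1 grid \<Rightarrow> 'a grid" where
  "sum_x q i j = q (i + 1) j + q i j"

definition wide_jump_x :: "'a::comm_ring_1 grid \<Rightarrow> 'a grid" where
  "wide_jump_x q i j = q (i + 1) j - q (i - 1) j"

definition wide_sum_x :: "'a::comm_ring_1 grid \<Rightarrow> 'a grid" where
  "wide_sum_x q i j = q (i + 1) j + 2 * q i j + q (i - 1) j"

definition jump_y :: "'a::comm_ring_1 grid \<Rightarrow> 'a grid" where
  "jump_y q i j = q i (j + 1) - q i j"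

definition sum_y :: "'a::comm_ring_1 grid \<Rightarrow> 'a grid" where
  "sum_y q i j = q i (j + 1) + q i j"

definition wide_jump_y :: "'a::comm_ring_1 grid \<Rightarrow> 'a grid" where
  "wide_jump_y q i j = q i (j + 1) - q i (j - 1)"

definition wide_sum_y :: "'a::comm_ring_1 grid \<Rightarrow> 'a grid" where
  "wide_sum_y q i j = q i (j + 1) + 2 * q i j + q i (j - 1)"

section \<open>Discrete divergences\<close>

definition edge_div_x :: "real \<Rightarrow> real \<Rightarrow> real grid \<Rightarrow> real grid \<Rightarrow> real grid" where
  "edge_div_x dx dy u v i j =
     wide_sum_y (jump_x u) i j / (4 * dx) + wide_jump_y (sum_x v) i j / (4 * dy)"

definition edge_div_y :: "real \<Rightarrow> real \<Rightarrow> real grid \<Rightarrow> real grid \<Rightarrow> real grid" where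
  "edge_div_y dx dy u v i j =
     sum_y (wide_jump_x u) i j / (4 * dx) + jump_y (wide_sum_x v) i j / (4 * dy)"

definition vertex_div :: "real \<Rightarrow> real \<Rightarrow> real grid \<Rightarrow> real grid \<Rightarrow> real grid" where
  "vertex_div dx dy u v i j =
     (u (i + 1) j - u i j + u (i + 1) (j + 1) - u i (j + 1)) / (2 * dx) +
     (v (i + 1) (j + 1) - v (i + 1) j + v i (j + 1) - v i j) / (2 * dy)"

section \<open>Numerical fluxes\<close>

text \<open>
  The numerical fluxes have the same form for every component of the system. Here \<open>q\<close> is the
  conserved component, and \<open>F\<close>, \<open>G\<close> are the cell values of the corresponding components of the
  physical fluxes in the two directions.
\<close>

definition num_flux_x ::
  "real \<Rightarrow> real \<Rightarrow> real \<Rightarrow> real grid \<Rightarrow> real grid \<Rightarrow> real grid \<Rightarrow> real grid \<Rightarrow> real grid" where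
  "num_flux_x dx dy dt u v F q i j =
     (1/8 * wide_sum_y (sum_x F) i j
        - 1/2 * \<bar>(u (i + 1) j + u i j) / 2\<bar> * jump_x q i j)
     / (1 + dt * edge_div_x dx dy u v i j)"

definition num_flux_y ::
  "real \<Rightarrow> real \<Rightarrow> real \<Rightarrow> real grid \<Rightarrow> real grid \<Rightarrow> real grid \<Rightarrow> real grid \<Rightarrow> real grid" where
  "num_flux_y dx dy dt u v G q i j =
     (1/8 * sum_y (wide_sum_x G) i j
        - 1/2 * \<bar>(v i (j + 1) + v i j) / 2\<bar> * jump_y q i j)
     / (1 + dt * edge_div_y dx dy u v i j)"

definition rhs ::
  "real \<Rightarrow> real \<Rightarrow> real \<Rightarrow> real grid \<Rightarrow> real grid \<Rightarrow> real grid \<Rightarrow> real grid \<Rightarrow> real grid \<Rightarrow> real grid"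
where
  "rhs dx dy dt u v F G q i j =
     (num_flux_x dx dy dt u v F q i j - num_flux_x dx dy dt u v F q (i - 1) j) / dx +
     (num_flux_y dx dy dt u v G q i j - num_flux_y dx dy dt u v G q i (j - 1)) / dy"

definition rhs_energy ::
  "real \<Rightarrow> real \<Rightarrow> real \<Rightarrow> real grid \<Rightarrow> real grid \<Rightarrow> real grid \<Rightarrow> real grid \<Rightarrow> real grid" where
  "rhs_energy dx dy dt u v e p =
     rhs dx dy dt u v (\<lambda>i j. u i j * (e i j + p i j)) (\<lambda>i j. v i j * (e i j + p i j)) e"

section \<open>Expansion in the Mach number\<close>

text \<open>
  Discrete quantities are formal power series in \<open>\<epsilon>\<close>, which is represented by \<open>fps_X\<close>.
  A division \<open>m / \<rho>\<close> of series is meaningful when the leading coefficient of \<open>\<rho>\<close> is nonzero.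
\<close>

definition eps_coeff :: "nat \<Rightarrow> real fps grid \<Rightarrow> real grid" where
  "eps_coeff l a i j = fps_nth (a i j) l"

definition velocity :: "real fps grid \<Rightarrow> real fps grid \<Rightarrow> real fps grid" where
  "velocity m \<rho> i j = m i j / \<rho> i j"

text \<open>The equation of state \<open>e = p / (\<gamma> - 1) + \<epsilon>\<^sup>2 \<rho> (u\<^sup>2 + v\<^sup>2) / 2\<close>, solved for \<open>p\<close>.\<close>

definition pressure ::
  "real \<Rightarrow> real fps grid \<Rightarrow> real fps grid \<Rightarrow> real fps grid \<Rightarrow> real fps grid \<Rightarrow> real fps grid" where
  "pressure \<gamma> \<rho> mx my e i j =
     fps_const (\<gamma> - 1) *
       (e i j - fps_const (1/2) * fps_X^2 * \<rho> i j *
          ((velocity mx \<rho> i j)^2 + (velocity my \<rho> i j)^2))"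

section \<open>Limit equations\<close>

definition limit_momentum_x ::
  "real \<Rightarrow> real \<Rightarrow> real \<Rightarrow> real grid \<Rightarrow> real grid \<Rightarrow> real grid \<Rightarrow> int \<Rightarrow> int \<Rightarrow> bool" where
  "limit_momentum_x dx dy dt u v p i j \<longleftrightarrow>
     1 / (8 * dx) *
       (wide_sum_y (sum_x p) i j / (1 + dt * edge_div_x dx dy u v i j)
        - wide_sum_y (sum_x p) (i - 1) j / (1 + dt * edge_div_x dx dy u v (i - 1) j)) = 0"

definition limit_momentum_y ::
  "real \<Rightarrow> real \<Rightarrow> real \<Rightarrow> real grid \<Rightarrow> real grid \<Rightarrow> real grid \<Rightarrow> int \<Rightarrow> int \<Rightarrow> bool" where
  "limit_momentum_y dx dy dt u v p i j \<longleftrightarrow>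
     1 / (8 * dy) *
       (sum_y (wide_sum_x p) i j / (1 + dt * edge_div_y dx dy u v i j)
        - sum_y (wide_sum_x p) i (j - 1) / (1 + dt * edge_div_y dx dy u v i (j - 1))) = 0"

definition limit_energy ::
  "real \<Rightarrow> real \<Rightarrow> real \<Rightarrow> real \<Rightarrow> real grid \<Rightarrow> real grid \<Rightarrow> real grid \<Rightarrow> real grid
     \<Rightarrow> int \<Rightarrow> int \<Rightarrow> bool" where
  "limit_energy dx dy dt \<gamma> u v e e_new i j \<longleftrightarrow>
     (e_new i j - e i j) / dt
       + rhs_energy dx dy dt u v e (\<lambda>i j. (\<gamma> - 1) * e i j) i j = 0"

end

theory Submission
  imports Defs
begin

text \<open>
  Every edge divergence is the mean of the vertex divergences at the two ends of the edge. A velocity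
  field whose vertex divergence vanishes therefore turns all the denominators \<open>1 + \<Delta>t d\<close> of the
  numerical fluxes into \<open>1\<close>. The momentum equations then only compare averages of the pressure
  coefficients on neighbouring edges, and these agree when the coefficients are constant.

  For the energy, the kinetic part of the equation of state carries a factor \<open>\<epsilon>\<^sup>2\<close>, so a constant
  leading pressure at both time levels forces the leading energy to be one constant \<open>E\<close> in space and
  in time. The upwind term then vanishes because it is proportional to the jumps of \<open>e\<close>, and the
  physical flux is \<open>\<gamma> E\<close> times the velocity. The transverse averages in the fluxes are
  chosen so that the divergence of such a flux is \<open>\<gamma> E\<close> times a mean of vertex divergences, namely
  of those at the four corners of the cell. Hence nothing changes the energy.
\<close>

text \<open>
  The weights \<open>1, 2, 1\<close> along the edge split as \<open>(1, 1, 0) + (0, 1, 1)\<close>, one pair for each end of the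
  edge, and the jump over two cells splits into the jumps over one.
\<close>

lemma edge_div_x_eq_mean_vertex_div:
  "edge_div_x dx dy u v i j = (vertex_div dx dy u v i j + vertex_div dx dy u v i (j - 1)) / 2"
  by (simp add: edge_div_x_def vertex_div_def wide_sum_y_def jump_x_def wide_jump_y_def sum_x_def
      add_divide_distrib diff_divide_distrib)

lemma edge_div_y_eq_mean_vertex_div:
  "edge_div_y dx dy u v i j = (vertex_div dx dy u v i j + vertex_div dx dy u v (i - 1) j) / 2"
  by (simp add: edge_div_y_def vertex_div_def sum_y_def wide_jump_x_def jump_y_def wide_sum_x_def
      add_divide_distrib diff_divide_distrib)

lemma limit_momentum_x_constant_pressure:
  assumes "\<And>i j. vertex_div dx dy u v i j = 0" and "\<And>i j. p i j = c"
  shows "limit_momentum_x dx dy dt u v p i j"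
  using assms
  by (simp add: limit_momentum_x_def edge_div_x_eq_mean_vertex_div wide_sum_y_def sum_x_def)

lemma limit_momentum_y_constant_pressure:
  assumes "\<And>i j. vertex_div dx dy u v i j = 0" and "\<And>i j. p i j = c"
  shows "limit_momentum_y dx dy dt u v p i j"
  using assms
  by (simp add: limit_momentum_y_def edge_div_y_eq_mean_vertex_div sum_y_def wide_sum_x_def)

text \<open>
  Without jumps in \<open>e\<close> the flux difference is the central divergence of the velocity, averaged in the
  transverse direction with weights \<open>1, 2, 1\<close>. These weights arise by adding up
  the four vertex divergences around the cell.
\<close>

lemma rhs_energy_uniform:
  assumes div: "\<And>i j. vertex_div dx dy u v i j = 0" and e: "\<And>i j. e i j = E" and p: "\<And>i j. p i j = P"
  shows "rhs_energy dx dy dt u v e p i j = 0"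
proof -
  have "rhs_energy dx dy dt u v e p i j =
      (E + P) / 8 * (wide_sum_y (wide_jump_x u) i j / dx + wide_sum_x (wide_jump_y v) i j / dy)"
    by (simp add: rhs_energy_def rhs_def num_flux_x_def num_flux_y_def
        edge_div_x_eq_mean_vertex_div edge_div_y_eq_mean_vertex_div div
        wide_sum_x_def wide_sum_y_def wide_jump_x_def wide_jump_y_def
        sum_x_def sum_y_def jump_x_def jump_y_def e p
        add_divide_distrib diff_divide_distrib algebra_simps)
  also have "\<dots> =
      (E + P) / 4 * (vertex_div dx dy u v i j + vertex_div dx dy u v (i - 1) j
                     + vertex_div dx dy u v i (j - 1) + vertex_div dx dy u v (i - 1) (j - 1))"
    by (simp add: vertex_div_def wide_sum_x_def wide_sum_y_def wide_jump_x_def wide_jump_y_def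
        add_divide_distrib diff_divide_distrib algebra_simps)
  finally show ?thesis by (simp add: div)
qed

text \<open>The kinetic energy enters the pressure only from order \<open>\<epsilon>\<^sup>2\<close> on.\<close>

lemma eps_coeff_0_pressure:
  "eps_coeff 0 (pressure \<gamma> \<rho> mx my e) i j = (\<gamma> - 1) * eps_coeff 0 e i j"
  by (simp add: eps_coeff_def pressure_def)

theorem theorem6p1:
  fixes \<rho> mx my e :: "nat \<Rightarrow> real fps grid"
    and dx dy dt \<gamma> :: real and n :: nat
  assumes "dx > 0" "dy > 0" "dt > 0" "\<gamma> > 1"
    and density: "\<forall>k\<in>{n, Suc n}. \<forall>i j. eps_coeff 0 (\<rho> k) i j \<noteq> 0"
    and pressure_const: "\<forall>l\<in>{0, 1}. \<exists>c. \<forall>k\<in>{n, Suc n}. \<forall>i j.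
          eps_coeff l (pressure \<gamma> (\<rho> k) (mx k) (my k) (e k)) i j = c"
    and div_free: "\<forall>k\<in>{n, Suc n}. \<forall>i j.
          vertex_div dx dy (eps_coeff 0 (velocity (mx k) (\<rho> n))) (eps_coeff 0 (velocity (my k) (\<rho> n))) i j = 0"
  shows "(\<forall>l\<in>{0, 1}. \<forall>i j.
            limit_momentum_x dx dy dt
              (eps_coeff 0 (velocity (mx n) (\<rho> n))) (eps_coeff 0 (velocity (my n) (\<rho> n)))
              (eps_coeff l (pressure \<gamma> (\<rho> n) (mx n) (my n) (e n))) i j \<and>
            limit_momentum_y dx dy dt
              (eps_coeff 0 (velocity (mx n) (\<rho> n))) (eps_coeff 0 (velocity (my n) (\<rho> n)))
              (eps_coeff l (pressure \<gamma> (\<rho> n) (mx n) (my n) (e n))) i j) \<and>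
         (\<forall>i j.
            limit_energy dx dy dt \<gamma>
              (eps_coeff 0 (velocity (mx (Suc n)) (\<rho> n))) (eps_coeff 0 (velocity (my (Suc n)) (\<rho> n)))
              (eps_coeff 0 (e n)) (eps_coeff 0 (e (Suc n))) i j)"
proof (intro conjI ballI allI)
  fix l :: nat and i j :: int
  assume "l \<in> {0, 1}"
  then obtain c where "\<And>i j. eps_coeff l (pressure \<gamma> (\<rho> n) (mx n) (my n) (e n)) i j = c"
    using pressure_const by blast
  then show
    "limit_momentum_x dx dy dt
       (eps_coeff 0 (velocity (mx n) (\<rho> n))) (eps_coeff 0 (velocity (my n) (\<rho> n)))
       (eps_coeff l (pressure \<gamma> (\<rho> n) (mx n) (my n) (e n))) i j"
    "limit_momentum_y dx dy dt
       (eps_coeff 0 (velocity (mx n) (\<rho> n))) (eps_coeff 0 (velocity (my n) (\<rho> n)))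
       (eps_coeff l (pressure \<gamma> (\<rho> n) (mx n) (my n) (e n))) i j"
    using div_free
    by (auto intro!: limit_momentum_x_constant_pressure limit_momentum_y_constant_pressure)
next
  fix i j :: int
  obtain c where c: "\<forall>k\<in>{n, Suc n}. \<forall>i j. (\<gamma> - 1) * eps_coeff 0 (e k) i j = c"
    using pressure_const by (auto simp: eps_coeff_0_pressure)
  \<comment> \<open>Both time levels share the constant \<open>c\<close>, so the time difference of the energy vanishes.\<close>
  have e: "eps_coeff 0 (e k) i j = c / (\<gamma> - 1)" if "k \<in> {n, Suc n}" for k i j
    using c that \<open>\<gamma> > 1\<close> by (auto simp: field_simps)
  have "rhs_energy dx dy dt
      (eps_coeff 0 (velocity (mx (Suc n)) (\<rho> n))) (eps_coeff 0 (velocity (my (Suc n)) (\<rho> n)))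
      (eps_coeff 0 (e n)) (\<lambda>i j. (\<gamma> - 1) * eps_coeff 0 (e n) i j) i j = 0"
    using div_free e c by (intro rhs_energy_uniform) auto
  then show "limit_energy dx dy dt \<gamma>
      (eps_coeff 0 (velocity (mx (Suc n)) (\<rho> n))) (eps_coeff 0 (velocity (my (Suc n)) (\<rho> n)))
      (eps_coeff 0 (e n)) (eps_coeff 0 (e (Suc n))) i j"
    by (simp add: limit_energy_def e)
qed

end
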